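(* Let $k\ge 2$ be an integer and let $a,b\in\mathbb{C}$ satisfy $a^2-b^2=1$, $|a|^2-|b|^2>0$, with $a,b$ linearly independent over $\mathbb{R}$. Then the generalized Jorge–Meeks $k$-noid $\hat{\mathbf{x}}_{a,b}$ is embedded in $\mathbb{R}^4_1$.
   Context: $\mathbb{R}^4_1$ is $\mathbb{R}^4$ with $\langle \mathbf{x},\mathbf{x}\rangle=x_1^2+x_2^2+x_3^2-x_4^2$. Let $\lambda=e^{2\pi\mathrm{i}/k}$ and $M=(\mathbb{C}\cup\{\infty\})\setminus\{\lambda^j: j=1,\dots,k\}$. The classical Jorge–Meeks $k$-noid $\mathbf{x}=(x_1,x_2,x_3,0):M\to\mathbb{R}^3\subset\mathbb{R}^4_1$ is $$\mathbf{x}=2\,\mathrm{Re}\int(\phi+\psi,-\mathrm{i}(\phi-\psi),1-\phi\psi,1+\phi\psi)\,\mathrm{d}h,\qquad \phi=\frac{-1}{\psi}=z^{k-1},\quad \mathrm{d}h=\frac{z^{k-1}\,\mathrm{d}z}{(z^k-1)^2}.$$ Write $\mathbf{x}_z=(v_1,v_2,v_3,0)$. The generalized $k$-noid is $$\hat{\mathbf{x}}_{a,b}=2\,\mathrm{Re}\int(v_1,v_2,a v_3,b v_3)\,\mathrm{d}z:\ M\to\mathbb{R}^4_1 ,$$ which is a well-defined complete regular spacelike surface of zero mean curvature. "Embedded" means without self-intersection. *)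

theory Defs
  imports "HOL-Complex_Analysis.Complex_Analysis"
begin

text \<open>
  The Riemann sphere is modelled by \<open>complex option\<close>, with \<open>None\<close> as the point at infinity.
  The ambient space is the vector space \<open>real^4\<close>; the Lorentzian form is not needed to say that
  a map into it has no self-intersections.
\<close>

definition knoid_domain :: "nat \<Rightarrow> complex option set" where
  "knoid_domain k = UNIV - (\<lambda>j. Some (exp (2 * of_real pi * \<i> / of_nat k) ^ j)) ` {1..k}"

definition knoid_phi :: "nat \<Rightarrow> complex \<Rightarrow> complex" where
  "knoid_phi k z = z ^ (k - 1)"

definition knoid_psi :: "nat \<Rightarrow> complex \<Rightarrow> complex" where
  "knoid_psi k z = - 1 / knoid_phi k z"

definition knoid_dh :: "nat \<Rightarrow> complex \<Rightarrow> complex" where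
  "knoid_dh k z = z ^ (k - 1) / (z ^ k - 1)\<^sup>2"

text \<open>
  The coefficient of the Weierstrass form of the classical $k$-noid; since $x = 2\,\mathrm{Re}\int
  \omega\,\mathrm{d}z$ has Wirtinger derivative $x_z = \omega$, this is $x_z$. The function
  $\psi$ has a pole at $0$, which cancels in the products with $\mathrm{d}h$. As division by zero
  yields \<open>0\<close>, the products have to be replaced by their analytic continuations to $0$, which is
  what \<open>remove_sings\<close> does.
\<close>

definition knoid_deriv :: "nat \<Rightarrow> complex \<Rightarrow> complex ^ 4" where
  "knoid_deriv k z = vector
     [remove_sings (\<lambda>w. (knoid_phi k w + knoid_psi k w) * knoid_dh k w) z,
      remove_sings (\<lambda>w. - \<i> * (knoid_phi k w - knoid_psi k w) * knoid_dh k w) z,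
      remove_sings (\<lambda>w. (1 - knoid_phi k w * knoid_psi k w) * knoid_dh k w) z,
      remove_sings (\<lambda>w. (1 + knoid_phi k w * knoid_psi k w) * knoid_dh k w) z]"

definition gen_knoid_deriv :: "nat \<Rightarrow> complex \<Rightarrow> complex \<Rightarrow> complex \<Rightarrow> complex ^ 4" where
  "gen_knoid_deriv k a b z = vector
     [knoid_deriv k z $ 1, knoid_deriv k z $ 2, a * knoid_deriv k z $ 3, b * knoid_deriv k z $ 3]"

text \<open>
  $2\,\mathrm{Re}\int_0^z \omega\,\mathrm{d}z$, the integral being taken along any path in \<open>S\<close>.
  The value is determined only if the integral does not depend on the path. The base point \<open>0\<close>
  fixes the surface, which is otherwise given up to a translation.
\<close>

definition re_path_integral :: "complex set \<Rightarrow> (complex \<Rightarrow> complex ^ 4) \<Rightarrow> complex \<Rightarrow> real ^ 4" where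
  "re_path_integral S \<omega> z = (THE p. \<forall>\<gamma>. valid_path \<gamma> \<and> path_image \<gamma> \<subseteq> S \<and>
      pathstart \<gamma> = 0 \<and> pathfinish \<gamma> = z \<longrightarrow>
      p = (\<chi> i. 2 * Re (contour_integral \<gamma> (\<lambda>w. \<omega> w $ i))))"

text \<open>
  The form extends holomorphically to infinity, so integration up to the point at infinity is the
  limit of the integrals over finite paths.
\<close>

definition gen_knoid :: "nat \<Rightarrow> complex \<Rightarrow> complex \<Rightarrow> complex option \<Rightarrow> real ^ 4" where
  "gen_knoid k a b p =
     (let X = re_path_integral {z. Some z \<in> knoid_domain k} (gen_knoid_deriv k a b)
      in case p of Some z \<Rightarrow> X z | None \<Rightarrow> Lim at_infinity X)"

lemma knoid_domain_Some_iff: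
  assumes "k \<ge> 2"
  shows "Some z \<in> knoid_domain k \<longleftrightarrow> z ^ k \<noteq> 1"
proof -
  let ?l = "exp (2 * of_real pi * \<i> / of_nat k) :: complex"
  have l: "?l ^ j = exp (2 * of_real pi * \<i> * of_nat j / of_nat k)" for j
    by (simp add: exp_of_nat_mult [symmetric] mult_ac)
  have lk: "?l ^ k = 1"
    using assms by (simp add: exp_of_nat_mult [symmetric] exp_two_pi_i)
  have "(\<exists>j\<in>{1..k}. z = ?l ^ j) \<longleftrightarrow> z ^ k = 1"
  proof
    assume "\<exists>j\<in>{1..k}. z = ?l ^ j"
    then show "z ^ k = 1"
      using lk by (metis mult.commute power_mult power_one)
  next
    assume "z ^ k = 1"
    then obtain j where j: "j < k" "z = ?l ^ j"
      using complex_roots_unity [of k] assms l by auto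
    show "\<exists>j\<in>{1..k}. z = ?l ^ j"
    proof (cases "j = 0")
      case True
      with j lk assms show ?thesis by (intro bexI [of _ k]) auto
    next
      case False
      with j show ?thesis by (intro bexI [of _ j]) auto
    qed
  qed
  then show ?thesis by (auto simp: knoid_domain_def)
qed

lemma remove_sings_eq_away_from_0:
  assumes "z ^ k \<noteq> (1::complex)" "isCont g z"
    and "\<And>w. w \<noteq> 0 \<Longrightarrow> w ^ k \<noteq> 1 \<Longrightarrow> f w = g w"
  shows "remove_sings f z = g z"
proof (rule remove_sings_eqI)
  have "open {w::complex. w ^ k \<noteq> 1}"
    by (intro open_Collect_neq continuous_intros)
  with assms(1) have "eventually (\<lambda>w. w ^ k \<noteq> 1) (at z)"
    by (intro eventually_at_in_open' [of "{w. w ^ k \<noteq> 1}", simplified]) auto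
  moreover have "eventually (\<lambda>w::complex. w \<noteq> 0) (at z)"
    by (cases "z = 0") (auto simp: eventually_neq_at_within)
  ultimately have "eventually (\<lambda>w. g w = f w) (at z)"
    by eventually_elim (simp add: assms(3))
  then show "f \<midarrow>z\<rightarrow> g z"
    using assms(2) by (simp add: isCont_def tendsto_cong)
qed

lemma vector_4_nth:
  "(vector [x1, x2, x3, x4] :: 'a::zero ^ 4) $ 1 = x1"
  "(vector [x1, x2, x3, x4] :: 'a::zero ^ 4) $ 2 = x2"
  "(vector [x1, x2, x3, x4] :: 'a::zero ^ 4) $ 3 = x3"
  "(vector [x1, x2, x3, x4] :: 'a::zero ^ 4) $ 4 = x4"
  by (simp_all add: vector_def)

lemma gen_knoid_deriv_eq:
  assumes "k \<ge> 2" "z ^ k \<noteq> 1"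
  shows "gen_knoid_deriv k a b z = vector
     [(z ^ (2 * k - 2) - 1) / (z ^ k - 1)\<^sup>2, - \<i> * (z ^ (2 * k - 2) + 1) / (z ^ k - 1)\<^sup>2,
      a * (2 * z ^ (k - 1) / (z ^ k - 1)\<^sup>2), b * (2 * z ^ (k - 1) / (z ^ k - 1)\<^sup>2)]"
proof -
  have p: "w ^ (2 * k - 2) = w ^ (k - 1) * w ^ (k - 1)" for w :: complex
    using assms(1) by (simp add: power_add [symmetric] mult_2 numeral_2_eq_2)
  note defs = knoid_phi_def knoid_psi_def knoid_dh_def
  have 1: "remove_sings (\<lambda>w. (knoid_phi k w + knoid_psi k w) * knoid_dh k w) z
        = (z ^ (k - 1) * z ^ (k - 1) - 1) / (z ^ k - 1)\<^sup>2"
    by (rule remove_sings_eq_away_from_0 [OF assms(2)])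
       (use assms(2) in \<open>auto intro!: continuous_intros simp: defs field_simps\<close>)
  have 2: "remove_sings (\<lambda>w. - \<i> * (knoid_phi k w - knoid_psi k w) * knoid_dh k w) z
        = - \<i> * (z ^ (k - 1) * z ^ (k - 1) + 1) / (z ^ k - 1)\<^sup>2"
    by (rule remove_sings_eq_away_from_0 [OF assms(2)])
       (use assms(2) in \<open>auto intro!: continuous_intros simp: defs field_simps\<close>)
  have 3: "remove_sings (\<lambda>w. (1 - knoid_phi k w * knoid_psi k w) * knoid_dh k w) z
        = 2 * z ^ (k - 1) / (z ^ k - 1)\<^sup>2"
    by (rule remove_sings_eq_away_from_0 [OF assms(2)])
       (use assms(2) in \<open>auto intro!: continuous_intros simp: defs field_simps\<close>)
  show ?thesis
    unfolding gen_knoid_deriv_def knoid_deriv_def vector_4_nth 1 2 3 p ..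
qed

end

theory Submission
  imports Defs
begin

text \<open>
  The last two coordinates of the surface are the real parts of \<open>a * c\<close> and \<open>b * c\<close>, where \<open>c\<close> is a
  primitive of $2 v_3$, namely a nonzero real multiple of $1 / (z^k-1)$ up to an additive constant. As
  \<open>a\<close> and \<open>b\<close> are linearly independent over the reals, these two numbers determine \<open>c\<close>
  (\<open>independent_pair_Re_mult_eq_0\<close>) and hence $z^k$. Two points with the same image are therefore
  related by a rotation $z' = l z$ with $l^k = 1$, or are both the point at infinity.

  The horizontal part $W = x_1 + \mathrm{i}\,x_2$ is that of the classical $k$-noid, and it is
  equivariant: $W(l z) = \overline{l}\,W(z)$ (\<open>knoid_horizontal_rotate\<close>). So the two points
  coincide as soon as $W(z) \neq 0$ for $z \neq 0, \infty$, that is, as soon as the classical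
  $k$-noid meets its axis only at the images of \<open>0\<close> and of infinity
  (\<open>knoid_horizontal_nonzero\<close>).

  By the symmetry of $W$ under inversion in the unit circle, let $|z| \le 1$, and write
  $z = r e$ with $|e| = 1$, $\sigma = e^k$. The Weierstrass data give, for $0 < t < r$,
  \[ \frac{\mathrm{d}}{\mathrm{d}t} \bigl(\overline{\sigma}\, e\, W(t e)\bigr)
       = 2 \bigl(t^{2k-2} q - \overline{q}\bigr), \qquad q = \frac{\sigma}{(1 - t^k \sigma)^2} . \]
  Up to the factor $t^k$, the number $q$ is the value at $t^k \sigma$ of the Koebe function
  $s / (1-s)^2$. Therefore its imaginary part has the sign of that of $\sigma$. If
  $\sigma$ is not real, the imaginary part $2 (t^{2k-2} + 1)\,\mathrm{Im}\,q$ of the derivative thus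
  has constant sign. If $\sigma = \pm 1$, then $q$ is real with the sign of $\sigma$, and the derivative
  $2 (t^{2k-2} - 1)\,q$ does not vanish. In both cases $W(t e)$ leaves \<open>0\<close> for good.

  All this is carried out on an explicit formula for $W$ (\<open>knoid_horizontal\<close>), whose differential is
  computed by means of the partial fractions of $1 / (z^k-1)$ and $z^{k-2} / (z^k-1)$. Being
  single-valued, it also shows that the path integrals defining the surface do not depend on the
  path.
\<close>

section \<open>Sums over roots of unity\<close>

lemma cmod_root_of_unity:
  assumes "w ^ k = (1::complex)" "k > 0"
  shows "cmod w = 1"
  using assms by (metis norm_one norm_power power_eq_1_iff norm_ge_zero neq0_conv)

lemma root_of_unity_mult_cnj:
  assumes "w ^ k = (1::complex)" "k > 0"
  shows "w * cnj w = 1"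
  using cmod_root_of_unity [OF assms] by (simp add: complex_norm_square [symmetric])

lemma root_of_unity_cnj:
  assumes "w ^ k = (1::complex)" "k > 0"
  shows "cnj w = w ^ (k - 1)"
proof -
  have "w * w ^ (k - 1) = 1"
    using assms by (simp add: power_eq_if)
  with root_of_unity_mult_cnj [OF assms] show ?thesis
    by (metis mult_left_cancel mult_zero_left zero_neq_one)
qed

lemma bij_betw_mult_roots_of_unity:
  assumes "l ^ k = (1::complex)" "k > 0"
  shows "bij_betw ((*) l) {w. w ^ k = 1} {w. w ^ k = 1}"
  by (rule bij_betw_byWitness [where f' = "(*) (inverse l)"])
     (use assms in \<open>auto simp: power_mult_distrib power_inverse zero_power field_simps\<close>)

text \<open>
  Multiplication by a primitive root \<open>l\<close> permutes the roots and multiplies the sum by \<open>l ^ n\<close>, which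
  differs from \<open>1\<close> unless \<open>k\<close> divides \<open>n\<close>.
\<close>

lemma sum_powers_roots_of_unity:
  assumes "k > 0"
  shows "(\<Sum>w::complex | w ^ k = 1. w ^ n) = (if k dvd n then of_nat k else 0)"
proof (cases "k dvd n")
  case True
  then obtain m where m: "n = k * m" by blast
  have "(\<Sum>w::complex | w ^ k = 1. w ^ n) = (\<Sum>w::complex | w ^ k = 1. 1)"
    by (intro sum.cong) (auto simp: m power_mult)
  with True assms show ?thesis by (simp add: card_roots_unity_eq)
next
  case False
  define l where "l = exp (2 * of_real pi * \<i> / of_nat k)"
  have lk: "l ^ k = 1"
    using assms by (simp add: l_def exp_of_nat_mult [symmetric])
  have "l ^ n = exp (2 * of_real pi * \<i> * of_nat n / of_nat k)"
    by (simp add: l_def exp_of_nat_mult [symmetric] mult_ac)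
  then have ln: "l ^ n \<noteq> 1"
    using False assms complex_root_unity_eq_1 [of k n] by simp
  have "(\<Sum>w | w ^ k = 1. w ^ n) = (\<Sum>w | w ^ k = 1. (l * w) ^ n)"
    by (rule sum.reindex_bij_betw [OF bij_betw_mult_roots_of_unity [OF lk assms], symmetric])
  also have "\<dots> = l ^ n * (\<Sum>w | w ^ k = 1. w ^ n)"
    by (simp add: power_mult_distrib sum_distrib_left)
  finally have "(1 - l ^ n) * (\<Sum>w | w ^ k = 1. w ^ n) = 0" by (simp add: algebra_simps)
  with ln False show ?thesis by simp
qed

text \<open>
  As \<open>z ^ k - 1 = z ^ k - w ^ k\<close> for each root \<open>w\<close>, the quotient \<open>(z ^ k - 1) / (z - w)\<close> is a
  geometric sum in \<open>z\<close> and \<open>w\<close>; summing over \<open>w\<close> leaves power sums of the roots, of which at most one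
  survives. The two instances below are the logarithmic parts of the Weierstrass forms.
\<close>

lemma sum_partial_fractions_roots_of_unity:
  fixes z :: complex
  assumes "k > 0" "z ^ k \<noteq> 1"
  shows "(\<Sum>w | w ^ k = 1. w ^ n / (z - w)) =
         (\<Sum>m<k. if k dvd n + k - Suc m then of_nat k * z ^ m else 0) / (z ^ k - 1)"
proof -
  have "(\<Sum>w | w ^ k = 1. w ^ n / (z - w)) * (z ^ k - 1)
      = (\<Sum>w | w ^ k = 1. \<Sum>m<k. z ^ m * w ^ (n + k - Suc m))"
    unfolding sum_distrib_right
  proof (rule sum.cong)
    fix w :: complex assume w: "w \<in> {w. w ^ k = 1}"
    with assms have ne: "z - w \<noteq> 0" by auto
    have "z ^ k - 1 = z ^ k - w ^ k" using w by simp
    also have "\<dots> = (z - w) * (\<Sum>m<k. w ^ (k - Suc m) * z ^ m)"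
      by (rule power_diff_sumr2)
    finally have "w ^ n / (z - w) * (z ^ k - 1) = w ^ n * (\<Sum>m<k. w ^ (k - Suc m) * z ^ m)"
      using ne by simp
    also have "\<dots> = (\<Sum>m<k. z ^ m * w ^ (n + k - Suc m))"
      unfolding sum_distrib_left by (intro sum.cong) (auto simp: power_add [symmetric] mult_ac)
    finally show "w ^ n / (z - w) * (z ^ k - 1) = (\<Sum>m<k. z ^ m * w ^ (n + k - Suc m))" .
  qed simp
  also have "\<dots> = (\<Sum>m<k. z ^ m * (\<Sum>w | w ^ k = 1. w ^ (n + k - Suc m)))"
    by (subst sum.swap) (simp add: sum_distrib_left)
  also have "\<dots> = (\<Sum>m<k. if k dvd n + k - Suc m then of_nat k * z ^ m else 0)"
    by (intro sum.cong) (auto simp: sum_powers_roots_of_unity [OF assms(1)])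
  finally show ?thesis using assms(2) by (simp add: field_simps)
qed

lemma sum_root_of_unity_over_diff:
  fixes z :: complex
  assumes "k > 0" "z ^ k \<noteq> 1"
  shows "(\<Sum>w | w ^ k = 1. w / (z - w)) = of_nat k / (z ^ k - 1)"
proof -
  have "k dvd 1 + k - Suc m \<longleftrightarrow> m = 0" if "m < k" for m
    using that by (auto dest: dvd_imp_le)
  then have "(\<Sum>m<k. if k dvd 1 + k - Suc m then of_nat k * z ^ m else 0)
      = (\<Sum>m<k. if m = 0 then of_nat k * z ^ m else 0)"
    by (intro sum.cong) auto
  with sum_partial_fractions_roots_of_unity [OF assms, of 1] assms(1) show ?thesis by simp
qed

lemma sum_cnj_root_of_unity_over_diff:
  fixes z :: complex
  assumes "k \<ge> 2" "z ^ k \<noteq> 1"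
  shows "(\<Sum>w | w ^ k = 1. cnj w / (z - w)) = of_nat k * z ^ (k - 2) / (z ^ k - 1)"
proof -
  have k: "k > 0" using assms by simp
  have "k dvd k - 1 + k - Suc m \<longleftrightarrow> m = k - 2" if m: "m < k" for m
  proof
    assume "k dvd k - 1 + k - Suc m"
    then obtain q where q: "k - 1 + k - Suc m = k * q" by blast
    have "q \<noteq> 0" using q m assms by (intro notI) simp
    moreover have "k * q < k * 2" using q k by linarith
    ultimately have "q = 1" by simp
    with q assms m show "m = k - 2" by simp
  next
    assume "m = k - 2"
    then have "k - 1 + k - Suc m = k" using assms by simp
    then show "k dvd k - 1 + k - Suc m" by simp
  qed
  then have "(\<Sum>m<k. if k dvd k - 1 + k - Suc m then of_nat k * z ^ m else 0)
      = (\<Sum>m<k. if m = k - 2 then of_nat k * z ^ m else 0)"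
    by (intro sum.cong) auto
  moreover have "(\<Sum>w | w ^ k = 1. cnj w / (z - w)) = (\<Sum>w | w ^ k = 1. w ^ (k - 1) / (z - w))"
    using k by (intro sum.cong) (auto simp: root_of_unity_cnj)
  ultimately show ?thesis
    using sum_partial_fractions_roots_of_unity [OF k assms(2), of "k - 1"] assms(1) by simp
qed

section \<open>The horizontal part of the surface\<close>

lemma has_derivative_ln_cmod:
  assumes "z \<noteq> w"
  shows "((\<lambda>z. ln (cmod (z - w))) has_derivative (\<lambda>h. Re (h / (z - w)))) (at z)"
proof -
  have "((\<lambda>z. z - w) has_derivative (\<lambda>h. h)) (at z)"
    by (auto intro!: derivative_eq_intros)
  then have "((\<lambda>z. cmod (z - w)) has_derivative (\<lambda>h. inner h (sgn (z - w)))) (at z)"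
    by (rule has_derivative_compose [OF _ has_derivative_norm]) (use assms in simp)
  then have "((\<lambda>z. ln (cmod (z - w))) has_derivative
      (\<lambda>h. inverse (cmod (z - w)) * (inner (sgn (z - w)) h))) (at z)"
    using assms by (auto intro!: derivative_eq_intros simp: inner_commute)
  moreover have "inverse (cmod d) * inner (sgn d) h = Re (h / d)" for d h
  proof -
    have "inverse (cmod d) * inner (sgn d) h = inner d h / (cmod d)\<^sup>2"
      by (simp add: sgn_div_norm power2_eq_square divide_simps)
    also have "\<dots> = Re (h / d)"
      by (simp add: Re_divide cmod_power2 inner_complex_def mult.commute)
    finally show ?thesis .
  qed
  ultimately show ?thesis by simp
qed

text \<open>
  This is $x_1 + \mathrm{i}\,x_2 = G + \overline{H}$, where $G$ and $H$ are the primitives vanishing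
  at \<open>0\<close> of $v_1 + \mathrm{i}\,v_2 = 2 z^{2k-2} / (z^k-1)^2$ and
  $v_1 - \mathrm{i}\,v_2 = -2 / (z^k-1)^2$. Both are multivalued, but at each root \<open>w\<close> of unity their
  residues are conjugate, so that the logarithms in the sum combine to $\ln|z-w|$.
\<close>

definition knoid_horizontal :: "nat \<Rightarrow> complex \<Rightarrow> complex" where
  "knoid_horizontal k z =
     2 / of_nat k * (cnj (z / (z ^ k - 1)) - z ^ (k - 1) / (z ^ k - 1)) +
     4 * (of_nat k - 1) / (of_nat k)\<^sup>2 * (\<Sum>w | w ^ k = 1. cnj w * of_real (ln (cmod (z - w))))"

lemma knoid_horizontal_has_derivative:
  assumes "k \<ge> 2" "z ^ k \<noteq> 1"
  shows "(knoid_horizontal k has_derivative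
     (\<lambda>h. 2 * z ^ (2 * k - 2) / (z ^ k - 1)\<^sup>2 * h + cnj (- 2 / (z ^ k - 1)\<^sup>2 * h))) (at z)"
proof -
  define D where "D = z ^ k - 1"
  obtain n where k: "k = n + 2" using assms(1) by (metis le_iff_add add.commute)
  have D: "D \<noteq> 0" using assms(2) by (simp add: D_def)
  then have D': "z ^ k - 1 \<noteq> 0" by (simp add: D_def)
  have k0: "of_nat k \<noteq> (0::complex)" using assms(1) by simp
  let ?d1 = "(D - of_nat k * z ^ k) / D\<^sup>2"
  let ?d2 = "((of_nat k - 1) * z ^ (k - 2) * D - of_nat k * z ^ (2 * k - 2)) / D\<^sup>2"
  have p1: "z * z ^ (k - 1) = z ^ k" by (simp add: k)
  have p2: "z ^ (k - 1) * z ^ (k - 1) = z ^ (2 * k - 2)"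
    by (simp add: k power_add [symmetric] mult_2)
  have dk: "((\<lambda>z. z ^ k - 1) has_field_derivative of_nat k * z ^ (k - 1)) (at z)"
    by (auto intro!: derivative_eq_intros)
  have dk1: "((\<lambda>z. z ^ (k - 1)) has_field_derivative (of_nat k - 1) * z ^ (k - 2)) (at z)"
    using DERIV_power [OF DERIV_ident, of "k - 1" z] by (simp add: k)
  have "((\<lambda>z. z / (z ^ k - 1)) has_field_derivative ?d1) (at z)"
    using DERIV_divide [OF DERIV_ident dk D']
    by (simp only: D_def power2_eq_square p1 mult.left_commute [of z] mult_1)
  then have 1: "((\<lambda>z. z / (z ^ k - 1)) has_derivative (\<lambda>h. ?d1 * h)) (at z)"
    by (simp only: has_field_derivative_def)
  have "((\<lambda>z. z ^ (k - 1) / (z ^ k - 1)) has_field_derivative ?d2) (at z)"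
    using DERIV_divide [OF dk1 dk D']
    by (simp only: D_def power2_eq_square p2 mult.left_commute [of "z ^ (k - 1)" "of_nat k"])
  then have 2: "((\<lambda>z. z ^ (k - 1) / (z ^ k - 1)) has_derivative (\<lambda>h. ?d2 * h)) (at z)"
    by (simp only: has_field_derivative_def)
  have 3: "((\<lambda>z. \<Sum>w | w ^ k = 1. cnj w * of_real (ln (cmod (z - w)))) has_derivative
      (\<lambda>h. \<Sum>w | w ^ k = 1. cnj w * of_real (Re (h / (z - w))))) (at z)"
    by (intro has_derivative_sum has_derivative_mult_right has_derivative_of_real
          has_derivative_ln_cmod) (use assms in auto)
  have 4: "(\<Sum>w | w ^ k = 1. cnj w * of_real (Re (h / (z - w))))
      = of_nat k / 2 * (z ^ (k - 2) / D * h + cnj (h / D))" for h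
  proof -
    have "2 * (\<Sum>w | w ^ k = 1. cnj w * of_real (Re (h / (z - w))))
        = (\<Sum>w | w ^ k = 1. h * (cnj w / (z - w)) + cnj (h * (w / (z - w))))"
      unfolding sum_distrib_left
    proof (rule sum.cong)
      fix w :: complex
      have "2 * of_real (Re (h / (z - w))) = h / (z - w) + cnj (h / (z - w))"
        by (simp only: complex_add_cnj) simp
      then have "cnj w * (2 * of_real (Re (h / (z - w)))) = cnj w * (h / (z - w) + cnj (h / (z - w)))"
        by (rule arg_cong)
      then show "2 * (cnj w * of_real (Re (h / (z - w)))) = h * (cnj w / (z - w)) + cnj (h * (w / (z - w)))"
        by (simp add: algebra_simps)
    qed simp
    also have "\<dots> = h * (\<Sum>w | w ^ k = 1. cnj w / (z - w)) + cnj (h * (\<Sum>w | w ^ k = 1. w / (z - w)))"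
      by (simp add: sum.distrib sum_distrib_left)
    also have "\<dots> = h * (of_nat k * z ^ (k - 2) / D) + cnj (h * (of_nat k / D))"
      using sum_cnj_root_of_unity_over_diff [OF assms] sum_root_of_unity_over_diff [of k z] assms
      by (simp add: D_def)
    finally show ?thesis by (simp add: field_simps)
  qed
  have "(knoid_horizontal k has_derivative
     (\<lambda>h. 2 / of_nat k * (cnj (?d1 * h) - ?d2 * h) +
        4 * (of_nat k - 1) / (of_nat k)\<^sup>2 * (of_nat k / 2 * (z ^ (k - 2) / D * h + cnj (h / D))))) (at z)"
    unfolding knoid_horizontal_def [abs_def]
    by (intro has_derivative_add has_derivative_mult_right has_derivative_diff
          has_derivative_cnj 1 2 3 [unfolded 4])
  moreover have "2 / of_nat k * (cnj (?d1 * h) - ?d2 * h) +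
        4 * (of_nat k - 1) / (of_nat k)\<^sup>2 * (of_nat k / 2 * (z ^ (k - 2) / D * h + cnj (h / D)))
     = 2 * z ^ (2 * k - 2) / D\<^sup>2 * h + cnj (- 2 / D\<^sup>2 * h)" for h
  proof -
    \<comment> \<open>The terms with $1 / (z^k-1)$ to the first power cancel between the rational part and the logarithms.\<close>
    have z_part: "2 / of_nat k * ?d2
        = 2 * (of_nat k - 1) / of_nat k * (z ^ (k - 2) / D) - 2 * z ^ (2 * k - 2) / D\<^sup>2"
      using D k0 by (simp add: field_simps power2_eq_square)
    have "D - of_nat k * z ^ k = - of_nat k - (of_nat k - 1) * D"
      by (simp add: D_def algebra_simps)
    then have "2 / of_nat k * ?d1 = 2 / of_nat k * (- of_nat k / D\<^sup>2 - (of_nat k - 1) / D)"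
      using D by (simp add: diff_divide_distrib power2_eq_square)
    moreover have "2 / K * (- K / E - (K - 1) / D) = - 2 / E - 2 * (K - 1) / K / D"
      if "K \<noteq> 0" for E K
      using that by (simp add: right_diff_distrib) (simp add: diff_divide_distrib left_diff_distrib)
    ultimately have "2 / of_nat k * ?d1 = - 2 / D\<^sup>2 - 2 * (of_nat k - 1) / of_nat k / D"
      using k0 by metis
    then have "cnj (2 / of_nat k * ?d1) = cnj (- 2 / D\<^sup>2 - 2 * (of_nat k - 1) / of_nat k / D)"
      by (rule arg_cong)
    then have cnj_part: "2 / of_nat k * cnj ?d1
        = cnj (- 2 / D\<^sup>2) - 2 * (of_nat k - 1) / of_nat k * cnj (1 / D)"
      by simp
    have log_part: "4 * (of_nat k - 1) / (of_nat k)\<^sup>2 * (of_nat k / 2)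
        = (2 * (of_nat k - 1) / of_nat k :: complex)"
      using k0 by (simp add: field_simps power2_eq_square)
    have expand: "c * (cnj (x * h) - y * h) + d * (e * (u * h + cnj (h / D)))
        = - (c * y) * h + (c * cnj x) * cnj h + (d * e) * u * h + (d * e) * cnj (1 / D) * cnj h"
      for c x y d e u
      by (simp add: algebra_simps)
    have collect: "- (c * u - s) * h + (x - c * v) * g + c * u * h + c * v * g = s * h + x * g"
      for c u v s x g :: complex
      by (simp add: algebra_simps)
    show ?thesis
      unfolding expand unfolding z_part cnj_part log_part unfolding collect
      by (simp only: complex_cnj_mult)
  qed
  ultimately show ?thesis by (simp only: D_def)
qed

lemma knoid_horizontal_0:
  assumes "k \<ge> 2"
  shows "knoid_horizontal k 0 = 0"
proof -
  have "(\<Sum>w | w ^ k = 1. cnj w * of_real (ln (cmod (0 - w)))) = 0"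
    by (intro sum.neutral) (use assms in \<open>auto simp: cmod_root_of_unity\<close>)
  with assms show ?thesis by (simp add: knoid_horizontal_def zero_power)
qed

text \<open>
  Turning the parameter by a root of unity turns the surface about its axis in the opposite sense:
  near \<open>0\<close>, the exponents in $G$ are \<open>-1\<close> modulo \<open>k\<close> and those in $H$ are \<open>1\<close> modulo \<open>k\<close>.
\<close>

lemma knoid_horizontal_rotate:
  assumes "k > 0" "l ^ k = 1"
  shows "knoid_horizontal k (l * z) = cnj l * knoid_horizontal k z"
proof -
  have l: "l ^ (k - 1) = cnj l" "cmod l = 1"
    using root_of_unity_cnj [OF assms(2,1)] cmod_root_of_unity [OF assms(2,1)] by simp_all
  have "(\<Sum>w | w ^ k = 1. cnj w * of_real (ln (cmod (l * z - w))))
      = (\<Sum>w | w ^ k = 1. cnj (l * w) * of_real (ln (cmod (l * z - l * w))))"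
    by (rule sum.reindex_bij_betw [OF bij_betw_mult_roots_of_unity [OF assms(2,1)], symmetric])
  also have "\<dots> = cnj l * (\<Sum>w | w ^ k = 1. cnj w * of_real (ln (cmod (z - w))))"
    unfolding sum_distrib_left
  proof (rule sum.cong)
    fix w
    have "cmod (l * z - l * w) = cmod (z - w)"
      using l(2) by (metis mult_1 norm_mult right_diff_distrib)
    then show "cnj (l * w) * of_real (ln (cmod (l * z - l * w)))
       = cnj l * (cnj w * of_real (ln (cmod (z - w))))" by simp
  qed simp
  finally show ?thesis
    using assms(2) l(1) by (simp add: knoid_horizontal_def power_mult_distrib algebra_simps)
qed

text \<open>
  Inversion in the unit circle reflects the classical surface in a horizontal plane. On the logarithms it
  divides each $|z-w|$ by $|z|$, which is harmless because the roots of unity add up to \<open>0\<close>.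
\<close>

lemma knoid_horizontal_inversion:
  assumes "k \<ge> 2" "z \<noteq> 0" "z ^ k \<noteq> 1"
  shows "knoid_horizontal k (1 / cnj z) = knoid_horizontal k z"
proof -
  have k: "k > 0" using assms(1) by simp
  have alg: "(1 / x) / ((1 / x) ^ k - 1) = - (x ^ (k - 1) / (x ^ k - 1))"
    "(1 / x) ^ (k - 1) / ((1 / x) ^ k - 1) = - (x / (x ^ k - 1))"
    if "x \<noteq> 0" "x ^ k \<noteq> 1" for x :: complex
  proof -
    obtain n where "k = Suc n" using k gr0_implies_Suc by blast
    with that show "(1 / x) / ((1 / x) ^ k - 1) = - (x ^ (k - 1) / (x ^ k - 1))"
      "(1 / x) ^ (k - 1) / ((1 / x) ^ k - 1) = - (x / (x ^ k - 1))"
      by (auto simp: power_one_over divide_simps) (auto simp: algebra_simps)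
  qed
  have czk: "cnj z ^ k \<noteq> 1"
    using assms(3) by (metis complex_cnj_cnj complex_cnj_one complex_cnj_power)
  have "(\<Sum>w | w ^ k = 1. cnj w * of_real (ln (cmod (1 / cnj z - w))))
      = (\<Sum>w | w ^ k = 1. cnj w * of_real (ln (cmod (z - w))) - of_real (ln (cmod z)) * cnj w)"
  proof (rule sum.cong)
    fix w :: complex
    assume "w \<in> {w. w ^ k = 1}"
    then have w: "w * cnj w = 1" "cmod w = 1" "z \<noteq> w"
      using root_of_unity_mult_cnj cmod_root_of_unity k assms(3) by auto
    have "1 / cnj z - w = - w * cnj (z - w) / cnj z"
      using w(1) assms(2) by (simp add: field_simps)
    then have "cmod (1 / cnj z - w) = cmod (z - w) / cmod z"
      using w(2) by (simp add: norm_mult norm_divide del: complex_cnj_diff)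
    then have "ln (cmod (1 / cnj z - w)) = ln (cmod (z - w)) - ln (cmod z)"
      using w(3) assms(2) by (simp add: ln_div)
    then show "cnj w * of_real (ln (cmod (1 / cnj z - w)))
        = cnj w * of_real (ln (cmod (z - w))) - of_real (ln (cmod z)) * cnj w"
      by (simp only: of_real_diff right_diff_distrib mult.commute)
  qed simp
  also have "\<dots> = (\<Sum>w | w ^ k = 1. cnj w * of_real (ln (cmod (z - w))))
      - of_real (ln (cmod z)) * cnj (\<Sum>w | w ^ k = 1. w)"
    by (simp add: sum_subtractf sum_distrib_left)
  also have "(\<Sum>w::complex | w ^ k = 1. w) = 0"
    using sum_roots_unity [of k] assms(1) by simp
  finally show ?thesis
    using alg [of "cnj z"] assms(2) czk by (simp add: knoid_horizontal_def)
qed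

section \<open>The surface meets its axis only over 0 and infinity\<close>

text \<open>
  The Koebe function $s / (1-s)^2$ preserves the sign of the imaginary part in the unit disc. For
  \<open>cmod s = 1\<close> the quotient below is the Koebe function at \<open>of_real r * s\<close>, divided by \<open>r\<close>; this form
  covers \<open>r = 0\<close> as well.
\<close>

lemma Koebe_Im_eq:
  assumes "cmod s = 1" "1 - of_real r * s \<noteq> 0"
  shows "Im (s / (1 - of_real r * s)\<^sup>2) = (1 - r\<^sup>2) * Im s / cmod (1 - of_real r * s) ^ 4"
proof -
  define d where "d = 1 - of_real r * s"
  have s: "s * cnj s = 1" using assms(1) by (simp add: complex_norm_square [symmetric])
  have "s * (cnj d)\<^sup>2 = s - 2 * of_real r * (s * cnj s) + (of_real r)\<^sup>2 * (s * cnj s) * cnj s"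
    by (simp add: d_def power2_eq_square algebra_simps)
  then have "s * (cnj d)\<^sup>2 = s - of_real (2 * r) + of_real (r\<^sup>2) * cnj s"
    by (simp add: s)
  then have *: "Im (s * (cnj d)\<^sup>2) = (1 - r\<^sup>2) * Im s"
    by (simp only:) (simp add: algebra_simps del: of_real_power)
  have "d\<^sup>2 * (cnj d)\<^sup>2 = of_real (cmod d ^ 4)"
    by (simp add: power_mult_distrib [symmetric] complex_norm_square [symmetric] flip: power_mult)
  moreover have "d \<noteq> 0" using assms(2) by (simp add: d_def)
  moreover from this have "cnj d \<noteq> 0" by simp
  ultimately have "s / d\<^sup>2 = s * (cnj d)\<^sup>2 / of_real (cmod d ^ 4)"
    by (metis mult_divide_mult_cancel_right power_not_zero)
  then have "Im (s / d\<^sup>2) = Im (s * (cnj d)\<^sup>2) / cmod d ^ 4"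
    by (simp only: Im_divide_of_real)
  with * show ?thesis by (simp add: d_def)
qed

text \<open>
  On the ray in direction \<open>e\<close>, the constant \<open>cnj (e ^ k) * e\<close> turns the derivatives of $G$ and
  $\overline{H}$ into nonnegative multiples of \<open>q\<close> and of \<open>- cnj q\<close>, so that the real and the
  imaginary part of the total are multiples of those of \<open>q\<close>.
\<close>

lemma knoid_horizontal_radial_derivative:
  fixes e :: complex and t :: real
  assumes "k \<ge> 2" "cmod e = 1" "(of_real t * e) ^ k \<noteq> 1"
  defines "q \<equiv> e ^ k / (1 - of_real (t ^ k) * e ^ k)\<^sup>2"
  shows "((\<lambda>t. cnj (e ^ k) * e * knoid_horizontal k (of_real t * e)) has_vector_derivative
      2 * (of_real (t ^ (2 * k - 2)) * q - cnj q)) (at t)"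
proof -
  define D where "D = (of_real t * e) ^ k - 1"
  have q: "q = e ^ k / D\<^sup>2"
    by (simp add: q_def D_def power_mult_distrib power2_commute)
  have e: "e * cnj e = 1" using assms(2) by (simp add: complex_norm_square [symmetric])
  then have ek: "e ^ k * cnj (e ^ k) = 1"
    by (metis complex_cnj_power power_mult_distrib power_one)
  have "e ^ (2 * k - 2) * e * e = e ^ (2 * k - 2 + 2)"
    by (simp add: power_add power2_eq_square mult.assoc)
  also have "2 * k - 2 + 2 = k + k" using assms(1) by simp
  finally have e2: "e ^ (2 * k - 2) * e * e = e ^ k * e ^ k" by (simp only: power_add)
  have ek2: "cnj (e ^ k) * (e ^ k * e ^ k) = e ^ k"
    using ek by (metis mult.assoc mult.commute mult_1)
  have "((\<lambda>t. of_real t * e) has_derivative (\<lambda>s. of_real s * e)) (at t)"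
    by (auto intro!: derivative_eq_intros)
  from has_derivative_compose [OF this knoid_horizontal_has_derivative [OF assms(1,3)]]
  have "((\<lambda>t. cnj (e ^ k) * e * knoid_horizontal k (of_real t * e)) has_derivative
     (\<lambda>s. cnj (e ^ k) * e * (2 * (of_real t * e) ^ (2 * k - 2) / D\<^sup>2 * (of_real s * e)
          + cnj (- 2 / D\<^sup>2 * (of_real s * e))))) (at t)"
    unfolding D_def by (rule has_derivative_mult_right)
  moreover have "cnj (e ^ k) * e * (2 * (of_real t * e) ^ (2 * k - 2) / D\<^sup>2 * (of_real s * e)
          + cnj (- 2 / D\<^sup>2 * (of_real s * e)))
      = s *\<^sub>R (2 * (of_real (t ^ (2 * k - 2)) * q - cnj q))" for s
  proof -
    have "cnj (e ^ k) * e * (2 * (of_real t * e) ^ (2 * k - 2) / D\<^sup>2 * (of_real s * e))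
        = of_real s * (2 * of_real (t ^ (2 * k - 2))) * (cnj (e ^ k) * (e ^ (2 * k - 2) * e * e)) / D\<^sup>2"
      by (simp add: power_mult_distrib)
    also have "\<dots> = of_real s * (2 * of_real (t ^ (2 * k - 2)) * q)"
      unfolding e2 ek2 q by simp
    finally have 1: "cnj (e ^ k) * e * (2 * (of_real t * e) ^ (2 * k - 2) / D\<^sup>2 * (of_real s * e))
        = of_real s * (2 * of_real (t ^ (2 * k - 2)) * q)" .
    have "cnj (e ^ k) * e * cnj (- 2 / D\<^sup>2 * (of_real s * e))
        = - 2 * of_real s * (e * cnj e) * cnj (e ^ k / D\<^sup>2)"
      by simp
    then have 2: "cnj (e ^ k) * e * cnj (- 2 / D\<^sup>2 * (of_real s * e)) = of_real s * (- 2 * cnj q)"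
      by (simp add: e q)
    show ?thesis
      unfolding distrib_left 1 2 by (simp add: scaleR_conv_of_real algebra_simps)
  qed
  ultimately show ?thesis by (simp add: has_vector_derivative_def)
qed

text \<open>
  Along the ray from \<open>0\<close> to \<open>z\<close>, the rotated position \<open>V\<close> starts at \<open>0\<close>. Its imaginary part is strictly
  monotone if \<open>e ^ k\<close> is not real, by the sign property of the Koebe function. If \<open>e ^ k\<close> is real, the
  ray lies in a plane of symmetry of the surface, \<open>V\<close> is real, and the real part is strictly monotone
  since \<open>t ^ (2 * k - 2) < 1\<close>. So \<open>V\<close> cannot return to \<open>0\<close>.
\<close>

lemma knoid_horizontal_nonzero_in_disc:
  assumes k: "k \<ge> 2" and z: "z \<noteq> 0" "z ^ k \<noteq> 1" "cmod z \<le> 1"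
  shows "knoid_horizontal k z \<noteq> 0"
proof
  assume W0: "knoid_horizontal k z = 0"
  define r where "r = cmod z"
  define e where "e = sgn z"
  define V where "V = (\<lambda>t. cnj (e ^ k) * e * knoid_horizontal k (of_real t * e))"
  define q where "q = (\<lambda>t::real. e ^ k / (1 - of_real (t ^ k) * e ^ k)\<^sup>2)"
  have e: "cmod e = 1" using z by (simp add: e_def norm_sgn)
  then have ek: "cmod (e ^ k) = 1" by (simp add: norm_power)
  have ze: "z = of_real r * e" using z by (simp add: e_def r_def sgn_div_norm scaleR_conv_of_real)
  have r: "0 < r" "r \<le> 1" using z by (simp_all add: r_def)
  \<comment> \<open>Roots of unity have modulus \<open>1\<close>, so on this segment only the endpoint \<open>z\<close> could be one.\<close>
  have dom: "(of_real t * e) ^ k \<noteq> 1" if "0 \<le> t" "t \<le> r" for t :: real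
  proof (cases "t = r")
    case False
    with that r have "t ^ k < 1" using k by (intro power_less_one_iff [THEN iffD2]) auto
    then have "cmod ((of_real t * e) ^ k) < 1" using that e by (simp add: norm_power norm_mult)
    then show ?thesis by auto
  qed (use z ze in simp)
  have V': "(V has_vector_derivative 2 * (of_real (t ^ (2 * k - 2)) * q t - cnj (q t))) (at t)"
    if "0 \<le> t" "t \<le> r" for t
    unfolding V_def q_def by (rule knoid_horizontal_radial_derivative [OF k e dom [OF that]])
  have V0: "V 0 = 0" by (simp add: V_def knoid_horizontal_0 [OF k])
  have Vr: "V r = 0" using W0 by (simp add: V_def ze)
  have contV: "continuous_on {0..r} V"
    by (rule continuous_on_vector_derivative) (use V' in \<open>auto intro: has_vector_derivative_at_within\<close>)
  have ReV: "((\<lambda>t. Re (V t)) has_real_derivative 2 * (t ^ (2 * k - 2) - 1) * Re (q t)) (at t)"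
    and ImV: "((\<lambda>t. Im (V t)) has_real_derivative 2 * (t ^ (2 * k - 2) + 1) * Im (q t)) (at t)"
    if "0 < t" "t < r" for t
  proof -
    note d = bounded_linear.has_vector_derivative [OF _ V', of _ t]
    show "((\<lambda>t. Re (V t)) has_real_derivative 2 * (t ^ (2 * k - 2) - 1) * Re (q t)) (at t)"
      using d [OF bounded_linear_Re] that
      by (simp add: has_real_derivative_iff_has_vector_derivative algebra_simps flip: of_real_power)
    show "((\<lambda>t. Im (V t)) has_real_derivative 2 * (t ^ (2 * k - 2) + 1) * Im (q t)) (at t)"
      using d [OF bounded_linear_Im] that
      by (simp add: has_real_derivative_iff_has_vector_derivative algebra_simps flip: of_real_power)
  qed
  have nz: "1 - of_real (t ^ k) * e ^ k \<noteq> 0" if "0 < t" "t < r" for t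
    using dom [of t] that by (simp add: power_mult_distrib)
  have small: "t ^ m < 1" if "0 < t" "t < r" "m > 0" for t m
    using that r by (intro power_less_one_iff [THEN iffD2]) auto
  show False
  proof (cases "Im (e ^ k) = 0")
    case False
    have "Im (e ^ k) * Im (V 0) < Im (e ^ k) * Im (V r)"
    proof (rule DERIV_pos_imp_increasing_open [OF r(1)])
      fix t assume t: "0 < t" "t < r"
      have "Im (q t) = (1 - (t ^ k)\<^sup>2) * Im (e ^ k) / cmod (1 - of_real (t ^ k) * e ^ k) ^ 4"
        unfolding q_def by (rule Koebe_Im_eq [OF ek nz [OF t]])
      then have "Im (e ^ k) * Im (q t)
          = (1 - (t ^ k)\<^sup>2) * (Im (e ^ k))\<^sup>2 / cmod (1 - of_real (t ^ k) * e ^ k) ^ 4"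
        by (simp add: power2_eq_square)
      moreover have "(t ^ k)\<^sup>2 < 1" using small [OF t, of "k * 2"] k by (simp add: power_mult)
      ultimately have "Im (e ^ k) * Im (q t) > 0" using nz [OF t] False by simp
      moreover have "2 * (t ^ (2 * k - 2) + 1) > 0" using t by (simp add: add_pos_pos)
      ultimately have "2 * (t ^ (2 * k - 2) + 1) * (Im (e ^ k) * Im (q t)) > 0"
        by (rule mult_pos_pos [rotated])
      with DERIV_cmult [OF ImV [OF t], of "Im (e ^ k)"]
      show "\<exists>y. ((\<lambda>t. Im (e ^ k) * Im (V t)) has_real_derivative y) (at t) \<and> y > 0"
        by (metis mult.left_commute)
    qed (intro continuous_intros contV)
    then show False by (simp add: V0 Vr)
  next
    case True
    define \<sigma> where "\<sigma> = Re (e ^ k)"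
    have \<sigma>: "e ^ k = of_real \<sigma>" "\<sigma> \<noteq> 0"
    proof -
      show "e ^ k = of_real \<sigma>" using True by (simp add: \<sigma>_def complex_eq_iff)
      with ek show "\<sigma> \<noteq> 0" by auto
    qed
    have "- \<sigma> * Re (V 0) < - \<sigma> * Re (V r)"
    proof (rule DERIV_pos_imp_increasing_open [OF r(1)])
      fix t assume t: "0 < t" "t < r"
      have nz': "1 - t ^ k * \<sigma> \<noteq> 0"
        using nz [OF t] unfolding \<sigma> by (metis of_real_1 of_real_diff of_real_eq_0_iff of_real_mult)
      have "q t = of_real (\<sigma> / (1 - t ^ k * \<sigma>)\<^sup>2)"
        by (simp add: q_def \<sigma>)
      then have "Re (q t) = \<sigma> / (1 - t ^ k * \<sigma>)\<^sup>2" by (simp only: Re_complex_of_real)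
      then have "\<sigma> * Re (q t) = \<sigma>\<^sup>2 / (1 - t ^ k * \<sigma>)\<^sup>2" by (simp add: power2_eq_square)
      then have "\<sigma> * Re (q t) > 0" using nz' \<sigma>(2) by simp
      moreover have "2 * (1 - t ^ (2 * k - 2)) > 0" using small [OF t, of "2 * k - 2"] k by simp
      ultimately have "2 * (1 - t ^ (2 * k - 2)) * (\<sigma> * Re (q t)) > 0"
        by (rule mult_pos_pos [rotated])
      moreover have "2 * (1 - t ^ (2 * k - 2)) * (\<sigma> * Re (q t))
          = - \<sigma> * (2 * (t ^ (2 * k - 2) - 1) * Re (q t))" by (simp add: algebra_simps)
      ultimately show "\<exists>y. ((\<lambda>t. - \<sigma> * Re (V t)) has_real_derivative y) (at t) \<and> y > 0"
        using DERIV_cmult [OF ReV [OF t], of "- \<sigma>"] by metis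
    qed (intro continuous_intros contV)
    then show False by (simp add: V0 Vr)
  qed
qed

lemma knoid_horizontal_nonzero:
  assumes "k \<ge> 2" "z \<noteq> 0" "z ^ k \<noteq> 1"
  shows "knoid_horizontal k z \<noteq> 0"
proof (cases "cmod z \<le> 1")
  case False
  have "cnj z ^ k \<noteq> 1"
    using assms(3) by (metis complex_cnj_cnj complex_cnj_one complex_cnj_power)
  then have "(1 / cnj z) ^ k \<noteq> 1" by (simp add: power_one_over)
  then have "knoid_horizontal k (1 / cnj z) \<noteq> 0"
    using assms False by (intro knoid_horizontal_nonzero_in_disc) (auto simp: norm_divide)
  with knoid_horizontal_inversion [OF assms] show ?thesis by simp
qed (use assms knoid_horizontal_nonzero_in_disc in auto)

section \<open>Evaluating the path integrals\<close>

text \<open>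
  The form \<open>f\<close> may have periods, as long as they are purely imaginary: it is enough that the real part
  of \<open>f z dz\<close> is the differential of a single-valued function.
\<close>

lemma Re_contour_integral_real_primitive:
  fixes u :: "complex \<Rightarrow> real"
  assumes u: "\<And>z. z \<in> S \<Longrightarrow> (u has_derivative (\<lambda>h. Re (f z * h))) (at z)"
    and f: "f contour_integrable_on g" and g: "valid_path g" "path_image g \<subseteq> S"
  shows "Re (contour_integral g f) = u (pathfinish g) - u (pathstart g)"
proof -
  let ?g' = "\<lambda>x. vector_derivative g (at x within {0..1})"
  from g(1) have "g piecewise_differentiable_on {0..1}"
    by (simp add: valid_path_def piecewise_C1_imp_differentiable)
  then obtain K where K: "finite K" "\<And>x. x \<in> {0..1} - K \<Longrightarrow> g differentiable (at x within {0..1})"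
    and cg: "continuous_on {0..1} g"
    by (auto simp: piecewise_differentiable_on_def)
  have inS: "g x \<in> S" if "x \<in> {0..1}" for x
    using that g(2) by (auto simp: path_image_def)
  have "continuous_on S u"
    using u by (meson continuous_at_imp_continuous_on has_derivative_continuous)
  then have "continuous_on {0..1} (\<lambda>x. u (g x))"
    by (rule continuous_on_compose2 [OF _ cg]) (use inS in auto)
  moreover have "((\<lambda>x. u (g x)) has_vector_derivative Re (f (g x) * ?g' x)) (at x)"
    if x: "x \<in> {0<..<1} - K" for x
  proof -
    have "(g has_vector_derivative ?g' x) (at x within {0..1})"
      using K(2) [of x] x by (simp add: vector_derivative_works)
    then have "(g has_vector_derivative ?g' x) (at x)"
      using x by (simp add: at_within_Icc_at)
    then have "(g has_derivative (\<lambda>s. s *\<^sub>R ?g' x)) (at x)"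
      by (simp add: has_vector_derivative_def)
    from has_derivative_compose [OF this u [OF inS]] x show ?thesis
      by (simp add: has_vector_derivative_def)
  qed
  ultimately have "((\<lambda>x. Re (f (g x) * ?g' x)) has_integral u (g 1) - u (g 0)) {0..1}"
    by (intro fundamental_theorem_of_calculus_interior_strong [OF K(1)]) auto
  moreover have "((\<lambda>x. Re (f (g x) * ?g' x)) has_integral Re (contour_integral g f)) {0..1}"
    using has_integral_linear [OF has_contour_integral_integral
        [OF f, unfolded has_contour_integral_def] bounded_linear_Re] by (simp add: o_def)
  ultimately show ?thesis
    by (auto simp: pathfinish_def pathstart_def intro: has_integral_unique)
qed

lemma re_path_integral_eq:
  fixes \<omega> :: "complex \<Rightarrow> complex ^ 4" and U :: "complex \<Rightarrow> real ^ 4"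
  assumes S: "open S" "connected S" "0 \<in> S" "z \<in> S"
    and \<omega>: "\<And>i. (\<lambda>w. \<omega> w $ i) holomorphic_on S"
    and U: "\<And>i w. w \<in> S \<Longrightarrow> ((\<lambda>w. U w $ i) has_derivative (\<lambda>h. 2 * Re (\<omega> w $ i * h))) (at w)"
  shows "re_path_integral S \<omega> z = U z - U 0"
proof -
  have val: "(\<chi> i. 2 * Re (contour_integral g (\<lambda>w. \<omega> w $ i))) = U z - U 0"
    if g: "valid_path g" "path_image g \<subseteq> S" "pathstart g = 0" "pathfinish g = z" for g
  proof -
    have "2 * Re (contour_integral g (\<lambda>w. \<omega> w $ i)) = U z $ i - U 0 $ i" for i
    proof -
      have "((\<lambda>w. U w $ i / 2) has_derivative (\<lambda>h. Re (\<omega> w $ i * h))) (at w)" if "w \<in> S" for w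
        using has_derivative_mult_right [OF U [OF that, of i], of "1 / 2"]
        by (simp del: times_complex.sel)
      from Re_contour_integral_real_primitive [OF this
          contour_integrable_holomorphic_simple [OF \<omega> S(1) g(1,2)] g(1,2)] g(3,4)
      show ?thesis by simp
    qed
    then show ?thesis by (simp add: vec_eq_iff)
  qed
  obtain g where "polynomial_function g" "path_image g \<subseteq> S" "pathstart g = 0" "pathfinish g = z"
    using connected_open_polynomial_connected [OF S] by blast
  then have "valid_path g \<and> path_image g \<subseteq> S \<and> pathstart g = 0 \<and> pathfinish g = z"
    by (simp add: valid_path_polynomial_function)
  with val show ?thesis
    unfolding re_path_integral_def by (intro the_equality) metis+
qed

text \<open>
  The surface up to a translation. The constant of integration is chosen so that the point at infinity
  goes to the origin; in the last two coordinates the additive constant then disappears.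
\<close>

definition knoid_potential :: "nat \<Rightarrow> complex \<Rightarrow> complex \<Rightarrow> complex \<Rightarrow> real ^ 4" where
  "knoid_potential k a b z = vector
     [Re (knoid_horizontal k z), Im (knoid_horizontal k z),
      - 4 / of_nat k * Re (a / (z ^ k - 1)), - 4 / of_nat k * Re (b / (z ^ k - 1))]"

lemma has_derivative_Re_over_power_diff:
  assumes "k > 0" "z ^ k \<noteq> (1::complex)"
  shows "((\<lambda>z. - 4 / of_nat k * Re (c / (z ^ k - 1))) has_derivative
     (\<lambda>h. 2 * Re (c * (2 * z ^ (k - 1) / (z ^ k - 1)\<^sup>2) * h))) (at z)"
proof -
  define D where "D = z ^ k - 1"
  have D: "D \<noteq> 0" using assms(2) by (simp add: D_def)
  have "((\<lambda>z. c / (z ^ k - 1)) has_field_derivative - (c * (of_nat k * z ^ (k - 1)) / D\<^sup>2)) (at z)"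
    using D unfolding D_def by (auto intro!: derivative_eq_intros simp: power2_eq_square)
  then have "((\<lambda>z. c / (z ^ k - 1)) has_derivative
      (\<lambda>h. - (c * (of_nat k * z ^ (k - 1)) / D\<^sup>2) * h)) (at z)"
    by (simp only: has_field_derivative_def)
  from has_derivative_mult_right [OF has_derivative_Re [OF this], of "- 4 / of_nat k"]
  have "((\<lambda>z. - 4 / of_nat k * Re (c / (z ^ k - 1))) has_derivative
     (\<lambda>h. - 4 / of_nat k * Re (- (c * (of_nat k * z ^ (k - 1)) / D\<^sup>2) * h))) (at z)" .
  moreover have "- 4 / of_nat k * Re (- (c * (of_nat k * z ^ (k - 1)) / D\<^sup>2) * h)
      = 2 * Re (c * (2 * z ^ (k - 1) / D\<^sup>2) * h)" for h
  proof -
    have 1: "- (c * (of_nat k * z ^ (k - 1)) / D\<^sup>2) * h = of_real (- of_nat k) * (c * z ^ (k - 1) / D\<^sup>2 * h)"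
      by simp
    have 2: "c * (2 * z ^ (k - 1) / D\<^sup>2) * h = of_real 2 * (c * z ^ (k - 1) / D\<^sup>2 * h)"
      by simp
    show ?thesis
      unfolding 1 2 Re_complex_of_real times_complex.sel Im_complex_of_real using assms(1) by simp
  qed
  ultimately show ?thesis by (simp only: D_def)
qed

lemma knoid_potential_has_derivative:
  assumes "k \<ge> 2" "z ^ k \<noteq> 1"
  shows "((\<lambda>z. knoid_potential k a b z $ i) has_derivative
     (\<lambda>h. 2 * Re (gen_knoid_deriv k a b z $ i * h))) (at z)"
proof -
  define D where "D = z ^ k - 1"
  have Re_double: "Re (of_real 2 * x) = 2 * Re x" for x by simp
  note dW = knoid_horizontal_has_derivative [OF assms, folded D_def]
  have k: "k > 0" using assms by simp
  have "i = 1 \<or> i = 2 \<or> i = 3 \<or> i = 4" by (rule exhaust_4)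
  moreover have ?thesis if i: "i = 1"
  proof -
    have "Re (2 * z ^ (2 * k - 2) / D\<^sup>2 * h + cnj (- 2 / D\<^sup>2 * h))
        = 2 * Re ((z ^ (2 * k - 2) - 1) / D\<^sup>2 * h)" for h
    proof -
      have "Re (2 * z ^ (2 * k - 2) / D\<^sup>2 * h + cnj (- 2 / D\<^sup>2 * h))
          = Re (2 * z ^ (2 * k - 2) / D\<^sup>2 * h + - 2 / D\<^sup>2 * h)"
        by (simp only: plus_complex.sel cnj.sel)
      also have "2 * z ^ (2 * k - 2) / D\<^sup>2 * h + - 2 / D\<^sup>2 * h
          = of_real 2 * ((z ^ (2 * k - 2) - 1) / D\<^sup>2 * h)"
        by (simp add: diff_divide_distrib algebra_simps)
      finally show ?thesis unfolding Re_double .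
    qed
    with has_derivative_Re [OF dW] show ?thesis
      by (simp only: i gen_knoid_deriv_eq [OF assms] knoid_potential_def vector_4_nth D_def)
  qed
  moreover have ?thesis if i: "i = 2"
  proof -
    have "Im (2 * z ^ (2 * k - 2) / D\<^sup>2 * h + cnj (- 2 / D\<^sup>2 * h))
        = 2 * Re (- \<i> * (z ^ (2 * k - 2) + 1) / D\<^sup>2 * h)" for h
    proof -
      have "Im (2 * z ^ (2 * k - 2) / D\<^sup>2 * h + cnj (- 2 / D\<^sup>2 * h))
          = Im (2 * z ^ (2 * k - 2) / D\<^sup>2 * h - - 2 / D\<^sup>2 * h)"
        by (simp only: plus_complex.sel minus_complex.sel cnj.sel)
      also have "\<dots> = Re (- \<i> * (2 * z ^ (2 * k - 2) / D\<^sup>2 * h - - 2 / D\<^sup>2 * h))"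
        by (simp only: times_complex.sel uminus_complex.sel imaginary_unit.sel)
      also have "- \<i> * (2 * z ^ (2 * k - 2) / D\<^sup>2 * h - - 2 / D\<^sup>2 * h)
          = of_real 2 * (- \<i> * (z ^ (2 * k - 2) + 1) / D\<^sup>2 * h)"
        unfolding divide_inverse by (simp add: ring_distribs mult.assoc mult.left_commute)
      finally show ?thesis unfolding Re_double .
    qed
    with has_derivative_Im [OF dW] show ?thesis
      by (simp only: i gen_knoid_deriv_eq [OF assms] knoid_potential_def vector_4_nth D_def)
  qed
  moreover have ?thesis if "i = 3 \<or> i = 4"
    using that has_derivative_Re_over_power_diff [OF k assms(2)]
    by (elim disjE) (simp_all only: gen_knoid_deriv_eq [OF assms] knoid_potential_def vector_4_nth)
  ultimately show ?thesis by blast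
qed

lemma gen_knoid_deriv_holomorphic:
  assumes "k \<ge> 2"
  shows "(\<lambda>z. gen_knoid_deriv k a b z $ i) holomorphic_on {z. z ^ k \<noteq> 1}"
proof -
  have eq: "(\<lambda>z. gen_knoid_deriv k a b z $ i) holomorphic_on {z. z ^ k \<noteq> 1} \<longleftrightarrow>
     (\<lambda>z. (vector
     [(z ^ (2 * k - 2) - 1) / (z ^ k - 1)\<^sup>2, - \<i> * (z ^ (2 * k - 2) + 1) / (z ^ k - 1)\<^sup>2,
      a * (2 * z ^ (k - 1) / (z ^ k - 1)\<^sup>2), b * (2 * z ^ (k - 1) / (z ^ k - 1)\<^sup>2)] :: complex ^ 4) $ i)
     holomorphic_on {z. z ^ k \<noteq> 1}"
    by (intro holomorphic_cong) (simp_all add: gen_knoid_deriv_eq [OF assms])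
  have "i = 1 \<or> i = 2 \<or> i = 3 \<or> i = 4" by (rule exhaust_4)
  then show ?thesis
    unfolding eq by (elim disjE) (auto simp: vector_4_nth intro!: holomorphic_intros)
qed

lemma re_path_integral_gen_knoid_deriv:
  assumes "k \<ge> 2" "z ^ k \<noteq> 1"
  shows "re_path_integral {z. Some z \<in> knoid_domain k} (gen_knoid_deriv k a b) z
    = knoid_potential k a b z - knoid_potential k a b 0"
proof -
  have "finite {z::complex. z ^ k = 1}" using assms(1) by (intro finite_roots_unity) simp
  then have "connected (- {z::complex. z ^ k = 1})"
    by (intro path_connected_imp_connected path_connected_complement_countable)
       (auto intro: countable_finite)
  then have conn: "connected {z::complex. z ^ k \<noteq> 1}" by (simp add: Compl_eq)
  have "{z. Some z \<in> knoid_domain k} = {z. z ^ k \<noteq> 1}"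
    using assms(1) by (simp add: knoid_domain_Some_iff)
  also have "re_path_integral \<dots> (gen_knoid_deriv k a b) z
    = knoid_potential k a b z - knoid_potential k a b 0"
  proof (rule re_path_integral_eq)
    show "open {z::complex. z ^ k \<noteq> 1}" by (intro open_Collect_neq continuous_intros)
    show "0 \<in> {z::complex. z ^ k \<noteq> 1}" "z \<in> {z. z ^ k \<noteq> 1}"
      using assms by (simp_all add: zero_power)
    show "(\<lambda>w. gen_knoid_deriv k a b w $ i) holomorphic_on {z. z ^ k \<noteq> 1}" for i
      by (rule gen_knoid_deriv_holomorphic [OF assms(1)])
    show "((\<lambda>w. knoid_potential k a b w $ i) has_derivative
        (\<lambda>h. 2 * Re (gen_knoid_deriv k a b w $ i * h))) (at w)" if "w \<in> {z. z ^ k \<noteq> 1}" for i w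
      by (rule knoid_potential_has_derivative [OF assms(1)]) (use that in simp)
  qed (rule conn)
  finally show ?thesis .
qed

text \<open>
  By the inversion symmetry, the horizontal part behaves at infinity as it does at \<open>0\<close>.
\<close>

lemma knoid_potential_at_infinity:
  assumes "k \<ge> 2"
  shows "(knoid_potential k a b \<longlongrightarrow> 0) at_infinity"
proof -
  have large: "eventually (\<lambda>z::complex. cmod z > 1) at_infinity"
    unfolding eventually_at_infinity by (intro exI [of _ 2]) auto
  have inv: "((\<lambda>z. 1 / cnj z) \<longlongrightarrow> 0) at_infinity"
  proof -
    have "((\<lambda>z. cnj (inverse z)) \<longlongrightarrow> cnj 0) at_infinity"
      by (intro tendsto_cnj tendsto_inverse_0)
    then show ?thesis by (simp add: divide_inverse)
  qed
  have "isCont (knoid_horizontal k) 0"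
    using knoid_horizontal_has_derivative [OF assms, of 0] assms
    by (intro has_derivative_continuous) (auto simp: zero_power)
  then have "((\<lambda>z. knoid_horizontal k (1 / cnj z)) \<longlongrightarrow> knoid_horizontal k 0) at_infinity"
    by (rule isCont_tendsto_compose [OF _ inv])
  moreover have "eventually (\<lambda>z. knoid_horizontal k (1 / cnj z) = knoid_horizontal k z) at_infinity"
    using large
  proof eventually_elim
    case (elim z)
    then have "cmod (z ^ k) > 1" using assms by (simp add: norm_power one_less_power)
    with elim assms show ?case by (intro knoid_horizontal_inversion) auto
  qed
  ultimately have W: "(knoid_horizontal k \<longlongrightarrow> 0) at_infinity"
    using knoid_horizontal_0 [OF assms] by (simp add: tendsto_cong)
  have "filterlim (\<lambda>z::complex. z ^ k - 1) at_infinity at_infinity"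
  proof -
    have "filterlim (\<lambda>z::complex. z ^ k) at_infinity at_infinity"
      using assms by (intro filterlim_power_at_infinity filterlim_ident) auto
    from tendsto_add_filterlim_at_infinity' [OF this tendsto_const [of "- 1"]]
    show ?thesis by simp
  qed
  then have C: "((\<lambda>z. c / (z ^ k - 1)) \<longlongrightarrow> 0) at_infinity" for c :: complex
    by (rule tendsto_divide_0 [OF tendsto_const])
  have C': "((\<lambda>z. - 4 / of_nat k * Re (c / (z ^ k - 1))) \<longlongrightarrow> 0) at_infinity" for c
    by (rule tendsto_mult_right_zero) (use tendsto_Re [OF C] in simp)
  show ?thesis
  proof (rule vec_tendstoI)
    fix i :: 4
    have "i = 1 \<or> i = 2 \<or> i = 3 \<or> i = 4" by (rule exhaust_4)
    then show "((\<lambda>z. knoid_potential k a b z $ i) \<longlongrightarrow> 0 $ i) at_infinity"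
      using tendsto_Re [OF W] tendsto_Im [OF W] C'
      by (elim disjE) (simp_all only: knoid_potential_def vector_4_nth zero_index zero_complex.sel)
  qed
qed

lemma gen_knoid_eq:
  assumes "k \<ge> 2" "p \<in> knoid_domain k"
  shows "gen_knoid k a b p =
    (case p of Some z \<Rightarrow> knoid_potential k a b z | None \<Rightarrow> 0) - knoid_potential k a b 0"
proof (cases p)
  case (Some z)
  with assms have "z ^ k \<noteq> 1" by (simp add: knoid_domain_Some_iff)
  with Some assms(1) show ?thesis
    by (simp add: gen_knoid_def re_path_integral_gen_knoid_deriv)
next
  case None
  let ?X = "re_path_integral {z. Some z \<in> knoid_domain k} (gen_knoid_deriv k a b)"
  have "eventually (\<lambda>z::complex. cmod z > 1) at_infinity"
    unfolding eventually_at_infinity by (intro exI [of _ 2]) auto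
  then have "eventually (\<lambda>z. knoid_potential k a b z - knoid_potential k a b 0 = ?X z) at_infinity"
  proof eventually_elim
    case (elim z)
    then have "cmod (z ^ k) > 1" using assms by (simp add: norm_power one_less_power)
    then have "z ^ k \<noteq> 1" by auto
    with assms(1) show ?case by (simp add: re_path_integral_gen_knoid_deriv)
  qed
  moreover have "((\<lambda>z. knoid_potential k a b z - knoid_potential k a b 0) \<longlongrightarrow>
      0 - knoid_potential k a b 0) at_infinity"
    by (intro tendsto_diff tendsto_const knoid_potential_at_infinity assms)
  ultimately have "(?X \<longlongrightarrow> 0 - knoid_potential k a b 0) at_infinity"
    by (rule Lim_transform_eventually [rotated])
  then have "Lim at_infinity ?X = 0 - knoid_potential k a b 0"
    by (rule tendsto_Lim [OF trivial_limit_at_infinity])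
  with None show ?thesis by (simp add: gen_knoid_def)
qed

section \<open>Injectivity\<close>

text \<open>
  Multiplication by \<open>c \<noteq> 0\<close> is a real isomorphism, and it would map the independent pair \<open>a\<close>, \<open>b\<close> into
  the imaginary axis, which is one-dimensional.
\<close>

lemma independent_pair_Re_mult_eq_0:
  fixes a b c :: complex
  assumes "a \<noteq> b" "independent {a, b}" "Re (a * c) = 0" "Re (b * c) = 0"
  shows "c = 0"
proof (rule ccontr)
  assume c: "c \<noteq> 0"
  define x where "x = Im (a * c)"
  define y where "y = Im (b * c)"
  have ac: "a * c = \<i> * of_real x" and bc: "b * c = \<i> * of_real y"
    using assms(3,4) by (intro complex_eqI; simp add: x_def y_def del: times_complex.sel)+
  have b: "b \<noteq> 0" and ab: "a \<notin> span {b}"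
    using assms(1,2) by (auto simp: independent_insert)
  have "of_real y * a * c = of_real x * b * c"
    unfolding mult.assoc ac bc by simp
  with c have yx: "y *\<^sub>R a = x *\<^sub>R b" by (simp add: scaleR_conv_of_real)
  have "y \<noteq> 0" using b bc c by auto
  then have "a = (1 / y) *\<^sub>R (y *\<^sub>R a)" by simp
  also have "\<dots> = (x / y) *\<^sub>R b" unfolding yx by simp
  also have "\<dots> \<in> span {b}" by (simp add: span_base span_scale)
  finally show False using ab by contradiction
qed

theorem proposition6p8:
  fixes k :: nat and a b :: complex
  assumes "k \<ge> 2"
    and "a\<^sup>2 - b\<^sup>2 = 1"
    and "(cmod a)\<^sup>2 - (cmod b)\<^sup>2 > 0"
    and "a \<noteq> b" and "independent {a, b}"
  shows "inj_on (gen_knoid k a b) (knoid_domain k)"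
proof (rule inj_onI)
  define P where "P = (\<lambda>p. case p of Some z \<Rightarrow> knoid_potential k a b z | None \<Rightarrow> 0)"
  define \<tau> :: "complex option \<Rightarrow> complex"
    where "\<tau> = (\<lambda>p. case p of Some z \<Rightarrow> 1 / (z ^ k - 1) | None \<Rightarrow> 0)"
  fix p p'
  assume p: "p \<in> knoid_domain k" "p' \<in> knoid_domain k"
    and "gen_knoid k a b p = gen_knoid k a b p'"
  then have P: "P p = P p'"
    using gen_knoid_eq [OF assms(1)] by (simp add: P_def)
  \<comment> \<open>The last two coordinates are real parts of multiples of \<open>\<tau>\<close>, with the factors \<open>a\<close> and \<open>b\<close>; together
    they determine \<open>\<tau>\<close>.\<close>
  have P34: "P q $ 3 = - 4 / of_nat k * Re (a * \<tau> q)" "P q $ 4 = - 4 / of_nat k * Re (b * \<tau> q)" for q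
    by (simp_all add: P_def \<tau>_def knoid_potential_def vector_4_nth
        split: option.split del: times_complex.sel)
  have "- 4 / of_nat k * Re (a * \<tau> p) = - 4 / of_nat k * Re (a * \<tau> p')"
    "- 4 / of_nat k * Re (b * \<tau> p) = - 4 / of_nat k * Re (b * \<tau> p')"
    unfolding P34 [symmetric] P by (rule refl)+
  then have "Re (a * (\<tau> p - \<tau> p')) = 0" "Re (b * (\<tau> p - \<tau> p')) = 0"
    using assms(1) by (simp_all add: right_diff_distrib del: times_complex.sel)
  then have "\<tau> p - \<tau> p' = 0"
    by (rule independent_pair_Re_mult_eq_0 [OF assms(4,5)])
  then have \<tau>: "\<tau> p = \<tau> p'" by simp
  have \<tau>_None: "\<tau> q = 0 \<longleftrightarrow> q = None" if "q \<in> knoid_domain k" for q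
    using that assms(1) by (cases q) (auto simp: \<tau>_def knoid_domain_Some_iff)
  show "p = p'"
  proof (cases p)
    case None
    with \<tau> \<tau>_None p show ?thesis by metis
  next
    case (Some z)
    with \<tau> \<tau>_None p obtain z' where p': "p' = Some z'" by (metis option.exhaust)
    have zk: "z ^ k \<noteq> 1" "z' ^ k \<noteq> 1"
      using p Some p' assms(1) by (simp_all add: knoid_domain_Some_iff)
    have eq: "z ^ k = z' ^ k"
      using \<tau> zk by (simp add: Some p' \<tau>_def field_simps)
    show ?thesis
    proof (cases "z = 0")
      case True
      with eq assms(1) show ?thesis by (simp add: Some p' zero_power)
    next
      case False
      define l where "l = z' / z"
      \<comment> \<open>The horizontal parts at \<open>z\<close> and \<open>z'\<close> agree, but they also differ by the rotation through
        \<open>cnj l\<close>; off the axis this forces \<open>l = 1\<close>.\<close>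
      have l: "l ^ k = 1" using eq [symmetric] False by (simp add: l_def power_divide)
      have z': "z' = l * z" using False by (simp add: l_def)
      have P1: "P p $ 1 = P p' $ 1" and P2: "P p $ 2 = P p' $ 2" by (simp_all add: P)
      have "knoid_horizontal k z = knoid_horizontal k z'"
        using P1 P2
        by (simp add: Some p' P_def knoid_potential_def vector_4_nth complex_eq_iff)
      also have "\<dots> = cnj l * knoid_horizontal k z"
        unfolding z' using knoid_horizontal_rotate [OF _ l] assms(1) by simp
      finally have "cnj l = 1"
        using knoid_horizontal_nonzero [OF assms(1) False zk(1)] by simp
      then have "l = 1" by (metis complex_cnj_cnj complex_cnj_one)
      then show ?thesis by (simp add: Some p' z')
    qed
  qed
qed

end
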